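(* Let $\mathcal{P}$ be a convex set of probability measures, and let $S\colon\mathcal{P}\to\mathcal{L}(\mathcal{P})$ be a strictly proper score on $\mathcal{P}$ whose associated negative entropy $G\colon\mathcal{P}\to\mathbb{R}$, $G(Q)=S(Q)\cdot Q$, is lower semicontinuous. Let $\hat f$ be an estimated prediction (a random variable with values in $\mathcal{P}$) and let $Y\sim Q\in\mathcal{P}$ be the target. Assume that each of the expectations below exists. Then $$\underbrace{\mathbb{E}\left[-S(\hat f)(Y)\right]}_{\text{Error}}=\underbrace{-G(Q)}_{\text{Noise}}+\underbrace{\mathbb{B}_{G^*}\left[S(\hat f)\right]}_{\text{"Variance"}}+\underbrace{d_{G^*,S^{-1}}\left(S(Q),\mathbb{E}\left[S(\hat f)\right]\right)}_{\text{Bias}}.$$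
   Context: $\mathcal{L}(\mathcal{P})$ is the vector space of functions $f$ with $\int|f|\,\mathrm{d}P<\infty$ for all $P\in\mathcal{P}$; $\mathrm{span}\,\mathcal{P}$ is the vector space of finite real linear combinations of elements of $\mathcal{P}$; the pairing between them is $f\cdot P=\int f\,\mathrm{d}P$. A score is a map $S\colon\mathcal{P}\to\mathcal{L}(\mathcal{P})$. Its expected value for prediction $P$ and target distribution $Q$ is $S(P)\cdot Q=\mathbb{E}_{Y\sim Q}[S(P)(Y)]$; for a random prediction $\hat f$, $\mathbb{E}[-S(\hat f)(Y)]$ is the expectation over $\hat f$ of this expected score, i.e. $-\mathbb{E}[S(\hat f)\cdot Q]$. The score is proper on $\mathcal{P}$ if $S(P)\cdot Q\le S(Q)\cdot Q$ for all $P,Q\in\mathcal{P}$, and strictly proper if moreover equality implies $P=Q$. For strictly proper $S$ on convex $\mathcal{P}$, $G$ is strictly convex with subgradient $S$, i.e. $G(Q)\ge G(P)+S(P)\cdot(Q-P)$ for all $P,Q\in\mathcal{P}$; $S$ is injective, and $S^{-1}$ denotes its inverse, defined on $S(\mathcal{P})=\{S(P)\mid P\in\mathcal{P}\}$. The convex conjugate of $G$ (with $G$ extended by $+\infty$ to $\mathrm{span}\,\mathcal{P}\setminus\mathcal{P}$) is $G^*(f)=\sup_{P\in\mathrm{span}\,\mathcal{P}}\left(f\cdot P-G(P)\right)$ for $f\in\mathcal{L}(\mathcal{P})$. The map $S^{-1}$ is a subgradient of $G^*$ on $S(\mathcal{P})$, and the restricted functional Bregman divergence is $d_{G^*,S^{-1}}(p',q')=G^*(q')-G^*(p')-(q'-p')\cdot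 S^{-1}(p')$, whose first argument $p'$ is restricted to $S(\mathcal{P})$. For a random variable $X$ with values in $\mathcal{L}(\mathcal{P})$, $\mathbb{E}[X]$ is its function-valued expectation, and the functional Bregman Information generated by $G^*$ is $\mathbb{B}_{G^*}[X]=\mathbb{E}[G^*(X)]-G^*(\mathbb{E}[X])$. *)

theory Defs
  imports "HOL-Probability.Probability"
begin

section \<open>The dual pair\<close>

text \<open>
  Throughout, \<open>\<P>\<close> is a set of probability measures on one measurable space \<open>M\<close>, i.e.
  \<open>\<P> \<subseteq> space (prob_algebra M)\<close>. The library has no signed measures, so elements of the
  span are represented by their set functions; \<open>measure P\<close> vanishes outside \<open>sets M\<close>, so
  \<open>P \<mapsto> measure P\<close> embeds \<open>\<P>\<close> injectively into \<open>signed_span \<P>\<close>.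
\<close>

definition integrable_functions :: "'a measure set \<Rightarrow> ('a \<Rightarrow> real) set" where
  "integrable_functions \<P> = {f. \<forall>P\<in>\<P>. integrable P f}"

definition signed_span :: "'a measure set \<Rightarrow> ('a set \<Rightarrow> real) set" where
  "signed_span \<P> = {\<lambda>A. \<Sum>P\<in>F. c P * measure P A | F c. finite F \<and> F \<subseteq> \<P>}"

text \<open>
  The pairing of \<open>f\<close> with a signed measure, i.e. the integral extended linearly from \<open>\<P>\<close> to its
  span; \<open>pairing_sum\<close> below shows that the value does not depend on the representation.
\<close>

definition pairing :: "'a measure set \<Rightarrow> ('a \<Rightarrow> real) \<Rightarrow> ('a set \<Rightarrow> real) \<Rightarrow> real" where
  "pairing \<P> f \<mu> = (THE r. \<exists>F c. finite F \<and> F \<subseteq> \<P> \<and>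
     \<mu> = (\<lambda>A. \<Sum>P\<in>F. c P * measure P A) \<and> r = (\<Sum>P\<in>F. c P * (\<integral>y. f y \<partial>P)))"

lemma sum_integral_eq_0:
  fixes f :: "'a \<Rightarrow> real"
  assumes "finite F" and F: "F \<subseteq> space (prob_algebra M)"
    and int: "\<And>P. P \<in> F \<Longrightarrow> integrable P f"
    and 0: "\<And>A. A \<in> sets M \<Longrightarrow> (\<Sum>P\<in>F. c P * measure P A) = 0"
  shows "(\<Sum>P\<in>F. c P * (\<integral>y. f y \<partial>P)) = 0"
proof (cases "F = {}")
  case False
  then obtain P0 where P0: "P0 \<in> F" by auto
  have sets: "sets P = sets M" and prob: "prob_space P" if "P \<in> F" for P
    using F that by (auto simp: space_prob_algebra)
  have sp: "space P = space M" if "P \<in> F" for P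
    using sets[OF that] by (rule sets_eq_imp_space_eq)
  have "f \<in> borel_measurable P0" using int[OF P0] by simp
  then have f: "f \<in> borel_measurable M"
    using measurable_cong_sets[OF sets[OF P0] refl] by blast
  obtain s where s: "\<And>i. simple_function M (s i)"
    "\<And>x. x \<in> space M \<Longrightarrow> (\<lambda>i. s i x) \<longlonglongrightarrow> f x"
    "\<And>i x. x \<in> space M \<Longrightarrow> norm (s i x) \<le> 2 * norm (f x)"
    using borel_measurable_implies_sequence_metric[OF f, of 0] by simp metis
  have "(\<Sum>P\<in>F. c P * (\<integral>y. s i y \<partial>P)) = 0" for i
  proof -
    have "(\<integral>y. s i y \<partial>P) = (\<Sum>v\<in>s i ` space M. v * measure P (s i -` {v} \<inter> space M))"
      if P: "P \<in> F" for P
    proof -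
      interpret prob_space P by (rule prob[OF P])
      let ?A = "\<lambda>v. s i -` {v} \<inter> space M"
      have A: "?A v \<in> sets P" for v
        using simple_functionD(2)[OF s(1)] by (simp add: sets[OF P])
      have "(\<integral>y. s i y \<partial>P) = (\<integral>y. (\<Sum>v\<in>s i ` space M. v * indicator (?A v) y) \<partial>P)"
      proof (rule Bochner_Integration.integral_cong[OF refl])
        fix y assume "y \<in> space P"
        then have y: "y \<in> space M" by (simp add: sp[OF P])
        have "(\<Sum>v\<in>s i ` space M. v * indicator (?A v) y) =
            (\<Sum>v\<in>s i ` space M. if v = s i y then v else 0)"
          using y by (intro sum.cong) (auto simp: indicator_def)
        then show "s i y = (\<Sum>v\<in>s i ` space M. v * indicator (?A v) y)"
          using y simple_functionD(1)[OF s(1)] by simp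
      qed
      also have "\<dots> = (\<Sum>v\<in>s i ` space M. \<integral>y. v * indicator (?A v) y \<partial>P)"
        using A by (intro Bochner_Integration.integral_sum) (simp add: less_top[symmetric])
      also have "\<dots> = (\<Sum>v\<in>s i ` space M. v * measure P (?A v))"
        using A by (intro sum.cong) auto
      finally show ?thesis .
    qed
    then have "(\<Sum>P\<in>F. c P * (\<integral>y. s i y \<partial>P)) =
        (\<Sum>P\<in>F. \<Sum>v\<in>s i ` space M. v * (c P * measure P (s i -` {v} \<inter> space M)))"
      by (intro sum.cong) (auto simp: sum_distrib_left mult_ac)
    also have "\<dots> = (\<Sum>v\<in>s i ` space M. v * (\<Sum>P\<in>F. c P * measure P (s i -` {v} \<inter> space M)))"
      by (subst sum.swap) (simp add: sum_distrib_left)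
    also have "\<dots> = 0"
      by (simp add: 0[OF simple_functionD(2)[OF s(1)]])
    finally show ?thesis .
  qed
  moreover have "(\<lambda>i. \<Sum>P\<in>F. c P * (\<integral>y. s i y \<partial>P)) \<longlonglongrightarrow> (\<Sum>P\<in>F. c P * (\<integral>y. f y \<partial>P))"
  proof (intro tendsto_sum tendsto_mult tendsto_const)
    fix P assume P: "P \<in> F"
    show "(\<lambda>i. \<integral>y. s i y \<partial>P) \<longlonglongrightarrow> (\<integral>y. f y \<partial>P)"
    proof (rule integral_dominated_convergence[where w = "\<lambda>x. 2 * norm (f x)"])
      show "f \<in> borel_measurable P" using int[OF P] by simp
      show "s i \<in> borel_measurable P" for i
        using borel_measurable_simple_function[OF s(1)] measurable_cong_sets[OF sets[OF P] refl]
        by blast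
      show "integrable P (\<lambda>x. 2 * norm (f x))" using int[OF P] by auto
    qed (use s(2,3) in \<open>auto simp: sp[OF P]\<close>)
  qed
  ultimately show ?thesis
    by (simp add: LIMSEQ_const_iff)
qed simp

lemma pairing_sum:
  assumes P: "\<P> \<subseteq> space (prob_algebra M)" and f: "f \<in> integrable_functions \<P>"
    and F: "finite F" "F \<subseteq> \<P>"
  shows "pairing \<P> f (\<lambda>A. \<Sum>P\<in>F. c P * measure P A) = (\<Sum>P\<in>F. c P * (\<integral>y. f y \<partial>P))"
  unfolding pairing_def
proof (rule the_equality)
  fix r
  assume "\<exists>F' c'. finite F' \<and> F' \<subseteq> \<P> \<and>
    (\<lambda>A. \<Sum>P\<in>F. c P * measure P A) = (\<lambda>A. \<Sum>P\<in>F'. c' P * measure P A) \<and>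
    r = (\<Sum>P\<in>F'. c' P * (\<integral>y. f y \<partial>P))"
  then obtain F' c' where F': "finite F'" "F' \<subseteq> \<P>"
    and eq: "\<And>A. (\<Sum>P\<in>F. c P * measure P A) = (\<Sum>P\<in>F'. c' P * measure P A)"
    and r: "r = (\<Sum>P\<in>F'. c' P * (\<integral>y. f y \<partial>P))"
    by (auto simp: fun_eq_iff)
  define d where "d P = (if P \<in> F then c P else 0) - (if P \<in> F' then c' P else 0)" for P
  have *: "(\<Sum>P\<in>F \<union> F'. d P * g P) = (\<Sum>P\<in>F. c P * g P) - (\<Sum>P\<in>F'. c' P * g P)"
    for g :: "'a measure \<Rightarrow> real"
  proof -
    have "(\<Sum>P\<in>F \<union> F'. (if P \<in> F then c P else 0) * g P) = (\<Sum>P\<in>F. c P * g P)"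
      using F F' by (intro sum.mono_neutral_cong_right) auto
    moreover have "(\<Sum>P\<in>F \<union> F'. (if P \<in> F' then c' P else 0) * g P) = (\<Sum>P\<in>F'. c' P * g P)"
      using F F' by (intro sum.mono_neutral_cong_right) auto
    ultimately show ?thesis
      by (simp add: d_def left_diff_distrib sum_subtractf)
  qed
  have "(\<Sum>P\<in>F \<union> F'. d P * (\<integral>y. f y \<partial>P)) = 0"
    using F F' P f
    by (intro sum_integral_eq_0[of _ M]) (auto simp: * eq integrable_functions_def)
  then show "r = (\<Sum>P\<in>F. c P * (\<integral>y. f y \<partial>P))"
    by (simp add: * r)
qed (use F in blast)

lemma pairing_measure:
  assumes "\<P> \<subseteq> space (prob_algebra M)" "f \<in> integrable_functions \<P>" "P \<in> \<P>"
  shows "pairing \<P> f (measure P) = (\<integral>y. f y \<partial>P)"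
  using pairing_sum[OF assms(1,2), of "{P}" "\<lambda>_. 1"] assms(3) by simp

text \<open>Closure under the mixtures \<open>t P + (1 - t) Q\<close>, formed in the span.\<close>

definition convex_measures :: "'a measure set \<Rightarrow> bool" where
  "convex_measures \<P> \<longleftrightarrow> (\<forall>P\<in>\<P>. \<forall>Q\<in>\<P>. \<forall>t\<in>{0..1}.
     (\<lambda>A. t * measure P A + (1 - t) * measure Q A) \<in> measure ` \<P>)"

text \<open>The topology on \<open>\<P>\<close> induced by the dual pair: the coarsest one making every
  \<open>P \<mapsto> \<integral>f dP\<close> with \<open>f \<in> integrable_functions \<P>\<close> continuous.\<close>

definition weak_topology :: "'a measure set \<Rightarrow> 'a measure topology" where
  "weak_topology \<P> = topology_generated_by
     {{P\<in>\<P>. (\<integral>y. f y \<partial>P) \<in> U} | f U. f \<in> integrable_functions \<P> \<and> open U}"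

definition lower_semicontinuous_map :: "'b topology \<Rightarrow> ('b \<Rightarrow> real) \<Rightarrow> bool" where
  "lower_semicontinuous_map T g \<longleftrightarrow> (\<forall>a. openin T {x \<in> topspace T. a < g x})"


section \<open>Scores\<close>

definition expected_score ::
    "('a measure \<Rightarrow> 'a \<Rightarrow> real) \<Rightarrow> 'a measure \<Rightarrow> 'a measure \<Rightarrow> real" where
  "expected_score S P Q = (\<integral>y. S P y \<partial>Q)"

definition proper_score :: "'a measure set \<Rightarrow> ('a measure \<Rightarrow> 'a \<Rightarrow> real) \<Rightarrow> bool" where
  "proper_score \<P> S \<longleftrightarrow> S ` \<P> \<subseteq> integrable_functions \<P> \<and>
     (\<forall>P\<in>\<P>. \<forall>Q\<in>\<P>. expected_score S P Q \<le> expected_score S Q Q)"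

definition strictly_proper_score :: "'a measure set \<Rightarrow> ('a measure \<Rightarrow> 'a \<Rightarrow> real) \<Rightarrow> bool" where
  "strictly_proper_score \<P> S \<longleftrightarrow> proper_score \<P> S \<and>
     (\<forall>P\<in>\<P>. \<forall>Q\<in>\<P>. expected_score S P Q = expected_score S Q Q \<longrightarrow> P = Q)"

definition neg_entropy :: "('a measure \<Rightarrow> 'a \<Rightarrow> real) \<Rightarrow> 'a measure \<Rightarrow> real" where
  "neg_entropy S Q = expected_score S Q Q"


section \<open>Convex conjugate and functional Bregman divergence\<close>

definition extend_by_infinity ::
    "'a measure set \<Rightarrow> ('a measure \<Rightarrow> real) \<Rightarrow> ('a set \<Rightarrow> real) \<Rightarrow> ereal" where
  "extend_by_infinity \<P> G \<mu> =
     (if \<mu> \<in> measure ` \<P> then ereal (G (inv_into \<P> measure \<mu>)) else \<infinity>)"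

definition convex_conjugate ::
    "'a measure set \<Rightarrow> ('a measure \<Rightarrow> real) \<Rightarrow> ('a \<Rightarrow> real) \<Rightarrow> ereal" where
  "convex_conjugate \<P> G f =
     (SUP \<mu>\<in>signed_span \<P>. ereal (pairing \<P> f \<mu>) - extend_by_infinity \<P> G \<mu>)"

text \<open>The divergence of \<open>H\<close> with subgradient selection \<open>h\<close>; it is only meaningful for \<open>p\<close> in the
  domain of \<open>h\<close>.\<close>

definition bregman_divergence ::
    "(('a \<Rightarrow> real) \<Rightarrow> ereal) \<Rightarrow> (('a \<Rightarrow> real) \<Rightarrow> 'a measure) \<Rightarrow> ('a \<Rightarrow> real) \<Rightarrow> ('a \<Rightarrow> real) \<Rightarrow> ereal" where
  "bregman_divergence H h p q = H q - H p - ereal (\<integral>y. (q y - p y) \<partial>(h p))"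


section \<open>Expectations and Bregman information\<close>

definition ereal_expectation :: "'w measure \<Rightarrow> ('w \<Rightarrow> ereal) \<Rightarrow> ereal" where
  "ereal_expectation \<Omega> Z =
     enn2ereal (\<integral>\<^sup>+\<omega>. e2ennreal (Z \<omega>) \<partial>\<Omega>) - enn2ereal (\<integral>\<^sup>+\<omega>. e2ennreal (- Z \<omega>) \<partial>\<Omega>)"

definition has_ereal_expectation :: "'w measure \<Rightarrow> ('w \<Rightarrow> ereal) \<Rightarrow> bool" where
  "has_ereal_expectation \<Omega> Z \<longleftrightarrow> Z \<in> borel_measurable \<Omega> \<and>
     ((\<integral>\<^sup>+\<omega>. e2ennreal (Z \<omega>) \<partial>\<Omega>) < \<infinity> \<or> (\<integral>\<^sup>+\<omega>. e2ennreal (- Z \<omega>) \<partial>\<Omega>) < \<infinity>)"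

definition function_expectation :: "'w measure \<Rightarrow> ('w \<Rightarrow> 'a \<Rightarrow> real) \<Rightarrow> 'a \<Rightarrow> real" where
  "function_expectation \<Omega> X = (\<lambda>y. \<integral>\<omega>. X \<omega> y \<partial>\<Omega>)"

text \<open>
  Existence of the function-valued expectation as an element of \<open>integrable_functions \<P>\<close>:
  joint measurability, and \<open>E[\<integral>|X| dP] < \<infinity>\<close> for each of the defining seminorms \<open>\<integral>|\<cdot>| dP\<close>.
  The pointwise integral may then fail to exist only on a set that is null for every \<open>P \<in> \<P>\<close>,
  where \<open>function_expectation\<close> is \<open>0\<close> by the library's convention.
\<close>

definition has_function_expectation ::
    "'w measure \<Rightarrow> 'a measure set \<Rightarrow> ('w \<Rightarrow> 'a \<Rightarrow> real) \<Rightarrow> bool" where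
  "has_function_expectation \<Omega> \<P> X \<longleftrightarrow> (\<forall>\<omega>\<in>space \<Omega>. X \<omega> \<in> integrable_functions \<P>) \<and>
     (\<forall>P\<in>\<P>. integrable (\<Omega> \<Otimes>\<^sub>M P) (\<lambda>(\<omega>, y). X \<omega> y))"

definition bregman_information ::
    "'w measure \<Rightarrow> (('a \<Rightarrow> real) \<Rightarrow> ereal) \<Rightarrow> ('w \<Rightarrow> 'a \<Rightarrow> real) \<Rightarrow> ereal" where
  "bregman_information \<Omega> H X =
     ereal_expectation \<Omega> (\<lambda>\<omega>. H (X \<omega>)) - H (function_expectation \<Omega> X)"

end

theory Submission
  imports Defs
begin

text \<open>
  By propriety, \<open>G\<^sup>* (S P) = (SUP P'\<in>\<P>. S P \<cdot> P' - S P' \<cdot> P') = 0\<close> for every \<open>P \<in> \<P>\<close>, so the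
  conjugate vanishes along the random score and at \<open>S Q\<close>. By Fubini, \<open>G\<^sup>*\<close> is nonpositive, hence
  finite, at the mean score. Its value there cancels between the variance and the bias, and what
  remains is \<open>- G Q - (E[S f] - S Q) \<cdot> Q = - E[S f \<cdot> Q]\<close>.
\<close>

text \<open>Membership in \<open>prob_algebra M\<close> fixes the sigma-algebra, and finiteness lets
  the real values determine \<open>emeasure\<close>. This is what makes
  \<open>inv_into \<P> measure\<close> in \<open>extend_by_infinity\<close> return the original
  measure.\<close>

lemma inj_on_measure:
  assumes "\<P> \<subseteq> space (prob_algebra M)"
  shows "inj_on measure \<P>"
proof (rule inj_onI)
  fix P Q assume "P \<in> \<P>" "Q \<in> \<P>" and eq: "measure P = measure Q"
  then have sets: "sets P = sets M" "sets Q = sets M" and prob: "prob_space P" "prob_space Q"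
    using assms by (auto simp: space_prob_algebra)
  then show "P = Q"
    by (intro measure_eqI)
      (auto simp: eq finite_measure.emeasure_eq_measure[OF prob_space.finite_measure])
qed

lemma measure_in_signed_span:
  assumes "P \<in> \<P>"
  shows "measure P \<in> signed_span \<P>"
  unfolding signed_span_def
  using assms by (intro CollectI exI[of _ "{P}"] exI[of _ "\<lambda>_. 1"]) auto

lemma convex_conjugate_eq_SUP:
  assumes P: "\<P> \<subseteq> space (prob_algebra M)" and f: "f \<in> integrable_functions \<P>"
  shows "convex_conjugate \<P> G f = (SUP P\<in>\<P>. ereal ((\<integral>y. f y \<partial>P) - G P))"
proof -
  have term_eq: "ereal (pairing \<P> f (measure P)) - extend_by_infinity \<P> G (measure P) =
      ereal ((\<integral>y. f y \<partial>P) - G P)" if "P \<in> \<P>" for P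
    using that inv_into_f_f[OF inj_on_measure[OF P] that]
    by (simp add: pairing_measure[OF P f] extend_by_infinity_def)
  show ?thesis
    unfolding convex_conjugate_def
  proof (rule antisym; rule SUP_least)
    fix \<mu>
    show "ereal (pairing \<P> f \<mu>) - extend_by_infinity \<P> G \<mu> \<le>
        (SUP P\<in>\<P>. ereal ((\<integral>y. f y \<partial>P) - G P))"
    proof (cases "\<mu> \<in> measure ` \<P>")
      case True
      then obtain P where "P \<in> \<P>" "\<mu> = measure P" by auto
      then show ?thesis by (auto simp: term_eq intro!: SUP_upper2[of P])
    qed (simp add: extend_by_infinity_def)
  next
    fix P assume "P \<in> \<P>"
    then show "ereal ((\<integral>y. f y \<partial>P) - G P) \<le>
        (SUP \<mu>\<in>signed_span \<P>. ereal (pairing \<P> f \<mu>) - extend_by_infinity \<P> G \<mu>)"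
      unfolding term_eq[symmetric, OF \<open>P \<in> \<P>\<close>] by (intro SUP_upper measure_in_signed_span)
  qed
qed

lemma convex_conjugate_score:
  assumes P: "\<P> \<subseteq> space (prob_algebra M)" and S: "proper_score \<P> S" and "P \<in> \<P>"
  shows "convex_conjugate \<P> (neg_entropy S) (S P) = 0"
proof -
  have "S P \<in> integrable_functions \<P>"
    using S \<open>P \<in> \<P>\<close> by (auto simp: proper_score_def)
  then have "convex_conjugate \<P> (neg_entropy S) (S P) =
      (SUP P'\<in>\<P>. ereal (expected_score S P P' - expected_score S P' P'))"
    by (simp add: convex_conjugate_eq_SUP[OF P] neg_entropy_def expected_score_def)
  also have "\<dots> = 0"
  proof (rule antisym)
    show "(SUP P'\<in>\<P>. ereal (expected_score S P P' - expected_score S P' P')) \<le> 0"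
      using S \<open>P \<in> \<P>\<close> by (intro SUP_least) (simp add: proper_score_def)
  \<comment> \<open>The bound is attained at \<open>P\<close> itself, where the two expected scores
    cancel.\<close>
  qed (use \<open>P \<in> \<P>\<close> in \<open>auto intro!: SUP_upper2[of P]\<close>)
  finally show ?thesis .
qed

text \<open>Serves to evaluate \<open>inv_into \<P> S (S Q)\<close> as \<open>Q\<close>, so that the
  divergence pairs with \<open>Q\<close>.\<close>

lemma inj_on_strictly_proper_score:
  assumes "strictly_proper_score \<P> S"
  shows "inj_on S \<P>"
proof (rule inj_onI)
  fix P Q assume "P \<in> \<P>" "Q \<in> \<P>" "S P = S Q"
  moreover from \<open>S P = S Q\<close> have "expected_score S P Q = expected_score S Q Q"
    by (simp add: expected_score_def)
  ultimately show "P = Q"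
    using assms by (auto simp: strictly_proper_score_def)
qed

text \<open>Applied for each \<open>P \<in> \<P>\<close>, this places the mean in
  \<open>integrable_functions \<P>\<close> and lets expectation commute with the pairing.\<close>

lemma function_expectation_Fubini:
  assumes P: "\<P> \<subseteq> space (prob_algebra M)" and \<Omega>: "prob_space \<Omega>"
    and X: "has_function_expectation \<Omega> \<P> X" and "P \<in> \<P>"
  shows "integrable P (function_expectation \<Omega> X)"
    and "integrable \<Omega> (\<lambda>\<omega>. \<integral>y. X \<omega> y \<partial>P)"
    and "(\<integral>y. function_expectation \<Omega> X y \<partial>P) = (\<integral>\<omega>. (\<integral>y. X \<omega> y \<partial>P) \<partial>\<Omega>)"
proof -
  interpret \<Omega>: prob_space \<Omega> by (rule \<Omega>)
  interpret P: prob_space P using P \<open>P \<in> \<P>\<close> by (auto simp: space_prob_algebra)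
  interpret pair_sigma_finite \<Omega> P ..
  have int: "integrable (\<Omega> \<Otimes>\<^sub>M P) (\<lambda>(\<omega>, y). X \<omega> y)"
    using X \<open>P \<in> \<P>\<close> by (simp add: has_function_expectation_def)
  show "integrable P (function_expectation \<Omega> X)"
    unfolding function_expectation_def by (rule integrable_snd[OF int])
  show "integrable \<Omega> (\<lambda>\<omega>. \<integral>y. X \<omega> y \<partial>P)"
    by (rule integrable_fst[OF int])
  show "(\<integral>y. function_expectation \<Omega> X y \<partial>P) = (\<integral>\<omega>. (\<integral>y. X \<omega> y \<partial>P) \<partial>\<Omega>)"
    unfolding function_expectation_def by (rule Fubini_integral[OF int])
qed

text \<open>Finiteness is what permits cancelling this value in \<open>ereal\<close> between the
  Bregman information and the divergence.\<close>

lemma convex_conjugate_mean_score_finite: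
  assumes P: "\<P> \<subseteq> space (prob_algebra M)" and S: "proper_score \<P> S"
    and \<Omega>: "prob_space \<Omega>" and f: "\<And>\<omega>. \<omega> \<in> space \<Omega> \<Longrightarrow> f \<omega> \<in> \<P>"
    and X: "has_function_expectation \<Omega> \<P> (\<lambda>\<omega>. S (f \<omega>))"
    and "\<P> \<noteq> {}"
  shows "\<bar>convex_conjugate \<P> (neg_entropy S) (function_expectation \<Omega> (\<lambda>\<omega>. S (f \<omega>)))\<bar> \<noteq> \<infinity>"
proof -
  interpret \<Omega>: prob_space \<Omega> by (rule \<Omega>)
  let ?m = "function_expectation \<Omega> (\<lambda>\<omega>. S (f \<omega>))"
  note Fubini = function_expectation_Fubini[OF P \<Omega> X]
  have "?m \<in> integrable_functions \<P>"
    using Fubini(1) by (simp add: integrable_functions_def)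
  then have eq: "convex_conjugate \<P> (neg_entropy S) ?m =
      (SUP P\<in>\<P>. ereal ((\<integral>y. ?m y \<partial>P) - neg_entropy S P))"
    by (rule convex_conjugate_eq_SUP[OF P])
  \<comment> \<open>Propriety bounds the score of each \<open>f \<omega>\<close> under
    \<open>P\<close> by \<open>neg_entropy S P\<close>; averaging over a probability space keeps
    this constant bound.\<close>
  have "(\<integral>y. ?m y \<partial>P) \<le> neg_entropy S P" if "P \<in> \<P>" for P
    unfolding Fubini(3)[OF that]
    using S f that
    by (intro \<Omega>.integral_le_const Fubini(2) AE_I2)
      (auto simp: proper_score_def neg_entropy_def expected_score_def)
  then have "convex_conjugate \<P> (neg_entropy S) ?m \<le> 0"
    unfolding eq by (intro SUP_least) simp
  \<comment> \<open>A single real term keeps the supremum above minus infinity; over an empty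
    \<open>\<P>\<close> there would be none.\<close>
  moreover obtain P where "P \<in> \<P>" using \<open>\<P> \<noteq> {}\<close> by auto
  then have "ereal ((\<integral>y. ?m y \<partial>P) - neg_entropy S P) \<le> convex_conjugate \<P> (neg_entropy S) ?m"
    unfolding eq by (rule SUP_upper)
  ultimately show ?thesis by auto
qed

theorem theorem3p2:
  fixes M :: "'a measure" and \<P> :: "'a measure set"
    and S :: "'a measure \<Rightarrow> 'a \<Rightarrow> real"
    and \<Omega> :: "'w measure" and f :: "'w \<Rightarrow> 'a measure" and Q :: "'a measure"
  assumes "\<P> \<subseteq> space (prob_algebra M)" and "convex_measures \<P>"
    and "strictly_proper_score \<P> S"
    and "lower_semicontinuous_map (weak_topology \<P>) (neg_entropy S)"
    and "prob_space \<Omega>" and "f \<in> \<Omega> \<rightarrow>\<^sub>M restrict_space (prob_algebra M) \<P>"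
    and "Q \<in> \<P>"
    and "integrable \<Omega> (\<lambda>\<omega>. \<integral>y. - S (f \<omega>) y \<partial>Q)"
    and "has_function_expectation \<Omega> \<P> (\<lambda>\<omega>. S (f \<omega>))"
    and "has_ereal_expectation \<Omega> (\<lambda>\<omega>. convex_conjugate \<P> (neg_entropy S) (S (f \<omega>)))"
  shows "ereal (\<integral>\<omega>. (\<integral>y. - S (f \<omega>) y \<partial>Q) \<partial>\<Omega>) =
    ereal (- neg_entropy S Q)
      + bregman_information \<Omega> (convex_conjugate \<P> (neg_entropy S)) (\<lambda>\<omega>. S (f \<omega>))
      + bregman_divergence (convex_conjugate \<P> (neg_entropy S)) (inv_into \<P> S)
          (S Q) (function_expectation \<Omega> (\<lambda>\<omega>. S (f \<omega>)))"
proof -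
  let ?H = "convex_conjugate \<P> (neg_entropy S)"
  let ?m = "function_expectation \<Omega> (\<lambda>\<omega>. S (f \<omega>))"
  note P = assms(1)
  have S: "proper_score \<P> S"
    using assms(3) by (simp add: strictly_proper_score_def)
  have f: "f \<omega> \<in> \<P>" if "\<omega> \<in> space \<Omega>" for \<omega>
    using measurable_space[OF assms(6) that] by (simp add: space_restrict_space)
  note Fubini = function_expectation_Fubini[OF P assms(5,9) \<open>Q \<in> \<P>\<close>]
  \<comment> \<open>The conjugate is known to vanish only for \<omega> in
    \<open>space \<Omega>\<close>, hence the rewriting under
    \<open>nn_integral_cong\<close>.\<close>
  have "ereal_expectation \<Omega> (\<lambda>\<omega>. ?H (S (f \<omega>))) = ereal_expectation \<Omega> (\<lambda>_. 0)"
    unfolding ereal_expectation_def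
    by (simp add: convex_conjugate_score[OF P S f] cong: nn_integral_cong)
  then have "ereal_expectation \<Omega> (\<lambda>\<omega>. ?H (S (f \<omega>))) = 0"
    by (simp add: ereal_expectation_def)
  moreover obtain g where "?H ?m = ereal g"
    using convex_conjugate_mean_score_finite[OF P S assms(5) f assms(9)] \<open>Q \<in> \<P>\<close> by auto
  \<comment> \<open>The linear term of the divergence: both summands are integrable under
    \<open>Q\<close>, so the integral splits. Its \<open>neg_entropy S Q\<close> cancels the noise
    term.\<close>
  moreover have "(\<integral>y. (?m y - S Q y) \<partial>Q) = (\<integral>\<omega>. (\<integral>y. S (f \<omega>) y \<partial>Q) \<partial>\<Omega>) - neg_entropy S Q"
  proof -
    have "integrable Q (S Q)"
      using S \<open>Q \<in> \<P>\<close> by (auto simp: proper_score_def integrable_functions_def)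
    then show ?thesis
      using Fubini by (simp add: neg_entropy_def expected_score_def)
  qed
  ultimately show ?thesis
    using \<open>Q \<in> \<P>\<close>
    by (simp add: bregman_information_def bregman_divergence_def convex_conjugate_score[OF P S]
        inv_into_f_f[OF inj_on_strictly_proper_score[OF assms(3)]])
qed

end
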